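(* Let $c\in\mathbb{R}$, $c\neq 0$, and consider the planar system $\dot x=y$, $\dot y=-cx^{2}$. In the chart $U_2$ of its Poincaré compactification the system is $$\dot u = v+cu^{3},\qquad \dot v = cu^{2}v,$$ and the critical point $(u,v)=(0,0)$ of this system is a node, stable if $c<0$ and unstable if $c>0$.
   Context: For a polynomial vector field $\dot x=P(x,y)$, $\dot y=Q(x,y)$ of degree $d$, its expression in the chart $U_2$ of the Poincaré compactification (coordinates $u=x/y$, $v=1/y$, with the points at infinity given by $v=0$) is $\dot u=v^{d}\left[P\left(\frac uv,\frac1v\right)-uQ\left(\frac uv,\frac1v\right)\right]$, $\dot v=-v^{d+1}Q\left(\frac uv,\frac1v\right)$. A (possibly non-hyperbolic) isolated critical point is a stable (attracting) node if every orbit starting sufficiently close to it tends to it as $t\to+\infty$ with a definite limiting tangent direction; it is an unstable (repelling) node if the same holds as $t\to-\infty$. *)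

theory Defs
  imports "HOL-Analysis.Analysis"
begin

text \<open>Polynomial vector fields of the plane are represented by their two component
  functions. As \<open>\<real>\<close> is infinite, these determine the polynomials and hence the degree.\<close>

definition bipoly_deg_le :: "nat \<Rightarrow> (real \<Rightarrow> real \<Rightarrow> real) \<Rightarrow> bool" where
  "bipoly_deg_le d f \<longleftrightarrow>
     (\<exists>a :: nat \<Rightarrow> nat \<Rightarrow> real. \<forall>x y. f x y = (\<Sum>i\<le>d. \<Sum>j\<le>d - i. a i j * x ^ i * y ^ j))"

text \<open>Meaningful only if \<open>P\<close> and \<open>Q\<close> are polynomial.\<close>

definition vf_degree :: "(real \<Rightarrow> real \<Rightarrow> real) \<Rightarrow> (real \<Rightarrow> real \<Rightarrow> real) \<Rightarrow> nat" where
  "vf_degree P Q = (LEAST d. bipoly_deg_le d P \<and> bipoly_deg_le d Q)"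

definition chart_U2_formula ::
    "(real \<Rightarrow> real \<Rightarrow> real) \<Rightarrow> (real \<Rightarrow> real \<Rightarrow> real) \<Rightarrow> real \<times> real \<Rightarrow> real \<times> real" where
  "chart_U2_formula P Q = (\<lambda>(u, v). let d = vf_degree P Q in
     (v ^ d * (P (u / v) (1 / v) - u * Q (u / v) (1 / v)),
      - (v ^ (d + 1) * Q (u / v) (1 / v))))"

text \<open>The defining formula divides by \<open>v\<close>. After cancellation it is polynomial in \<open>u\<close>, \<open>v\<close>;
  its values on the line at infinity \<open>v = 0\<close> are therefore those of the continuous extension
  (and not what \<open>x / 0 = 0\<close> would yield).\<close>

definition chart_U2 ::
    "(real \<Rightarrow> real \<Rightarrow> real) \<Rightarrow> (real \<Rightarrow> real \<Rightarrow> real) \<Rightarrow> real \<times> real \<Rightarrow> real \<times> real" where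
  "chart_U2 P Q p =
     (if snd p \<noteq> 0 then chart_U2_formula P Q p
      else Lim (at p within {q. snd q \<noteq> 0}) (chart_U2_formula P Q))"

definition solves_ode :: "(real \<times> real \<Rightarrow> real \<times> real) \<Rightarrow> real set \<Rightarrow> (real \<Rightarrow> real \<times> real) \<Rightarrow> bool" where
  "solves_ode F I x \<longleftrightarrow>
     open I \<and> is_interval I \<and> (\<forall>t\<in>I. (x has_vector_derivative F (x t)) (at t))"

text \<open>The values of \<open>x\<close> outside \<open>I\<close> are irrelevant.\<close>

definition maximal_orbit_from ::
    "(real \<times> real \<Rightarrow> real \<times> real) \<Rightarrow> real \<times> real \<Rightarrow> real set \<Rightarrow> (real \<Rightarrow> real \<times> real) \<Rightarrow> bool" where
  "maximal_orbit_from F q I x \<longleftrightarrow>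
     0 \<in> I \<and> x 0 = q \<and> solves_ode F I x \<and>
     (\<forall>J z. solves_ode F J z \<and> I \<subseteq> J \<and> (\<forall>t\<in>I. z t = x t) \<longrightarrow> J = I)"

definition isolated_critical_point :: "(real \<times> real \<Rightarrow> real \<times> real) \<Rightarrow> real \<times> real \<Rightarrow> bool" where
  "isolated_critical_point F p \<longleftrightarrow>
     F p = 0 \<and> (\<exists>e>0. \<forall>q. q \<noteq> p \<and> dist q p < e \<longrightarrow> F q \<noteq> 0)"

text \<open>\<open>sgn z\<close> is the unit vector \<open>z /\<^sub>R norm z\<close>. Since \<open>sgn 0 = 0\<close>, the condition \<open>norm w = 1\<close>
  makes \<open>w\<close> a genuine direction.\<close>

definition tends_with_tangent ::
    "(real \<Rightarrow> real \<times> real) \<Rightarrow> real \<times> real \<Rightarrow> real filter \<Rightarrow> bool" where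
  "tends_with_tangent x p T \<longleftrightarrow>
     (x \<longlongrightarrow> p) T \<and> (\<exists>w. norm w = 1 \<and> ((\<lambda>t. sgn (x t - p)) \<longlongrightarrow> w) T)"

text \<open>Only the constant orbit at \<open>p\<close> itself, which has no tangent, is exempted below.\<close>

definition stable_node :: "(real \<times> real \<Rightarrow> real \<times> real) \<Rightarrow> real \<times> real \<Rightarrow> bool" where
  "stable_node F p \<longleftrightarrow> isolated_critical_point F p \<and>
     (\<exists>e>0. \<forall>q I x. q \<noteq> p \<and> dist q p < e \<and> maximal_orbit_from F q I x \<longrightarrow>
        {0..} \<subseteq> I \<and> tends_with_tangent x p at_top)"

definition unstable_node :: "(real \<times> real \<Rightarrow> real \<times> real) \<Rightarrow> real \<times> real \<Rightarrow> bool" where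
  "unstable_node F p \<longleftrightarrow> isolated_critical_point F p \<and>
     (\<exists>e>0. \<forall>q I x. q \<noteq> p \<and> dist q p < e \<and> maximal_orbit_from F q I x \<longrightarrow>
        {..0} \<subseteq> I \<and> tends_with_tangent x p at_bot)"

definition node :: "(real \<times> real \<Rightarrow> real \<times> real) \<Rightarrow> real \<times> real \<Rightarrow> bool" where
  "node F p \<longleftrightarrow> stable_node F p \<or> unstable_node F p"

end

theory Submission
  imports Defs
begin

text \<open>Let \<open>w = 3 * v + 2 * c * u ^ 3\<close>. Along an orbit \<open>v' = c * u\<^sup>2 * v\<close> and \<open>w' = 3 * c * u\<^sup>2 * w\<close>, hence
  \<open>v = v\<^sub>0 * h\<close> and \<open>w = w\<^sub>0 * h ^ 3\<close> with \<open>h = exp (c * \<integral> u\<^sup>2)\<close>. For \<open>c < 0\<close> the factor \<open>h\<close> is positive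
  and decreasing. So \<open>v\<close>, \<open>w\<close> and \<open>u\<close> are bounded, the orbit exists for all positive times and
  converges, and its limit is a critical point, that is, the origin. If \<open>v\<^sub>0 \<noteq> 0\<close>, then
  \<open>u ^ 3 \<sim> - 3 * v / (2 * c)\<close>, and if \<open>v\<^sub>0 = 0\<close>, then \<open>v = 0\<close>: in both cases \<open>v / u \<longlonglongrightarrow> 0\<close> and \<open>u\<close> is
  eventually of constant sign, so the orbit is tangent to the \<open>u\<close>-axis. The reflection \<open>u \<mapsto> - u\<close>
  together with reversal of time exchanges \<open>c\<close> and \<open>- c\<close>.\<close>

subsection \<open>Local existence and continuation of bounded solutions\<close>

text \<open>The Picard integral operator contracts the Banach space of bounded continuous functions,
  and its fixed point solves the integral equation. A global Lipschitz constant removes the need to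
  confine the iterates to a ball.\<close>

lemma picard_lindelof_right:
  fixes G :: "'a::banach \<Rightarrow> 'a"
  assumes lip: "L-lipschitz_on UNIV G"
  obtains h y where "h > 0" "y b = p"
    "\<And>t. t \<in> {b..b + h} \<Longrightarrow> (y has_vector_derivative G (y t)) (at t within {b..b + h})"
proof -
  have L0: "L \<ge> 0" using lip by (rule lipschitz_on_nonneg)
  \<comment> \<open>This length makes the contraction factor \<open>L * h\<close> at most 1/2; the
    summand 1 guards against \<open>L = 0\<close>.\<close>
  define h where "h = 1 / (2 * (L + 1))"
  have h0: "h > 0" and hL: "L * h \<le> 1 / 2"
    using L0 by (auto simp: h_def field_simps)
  define cl where "cl t = max b (min (b + h) t)" for t
  have cl: "cl t \<in> {b..b + h}" "t \<in> {b..b + h} \<Longrightarrow> cl t = t" for t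
    using h0 by (auto simp: cl_def)
  have contG: "continuous_on S (\<lambda>s. G (apply_bcontfun \<phi> s))" for S and \<phi> :: "real \<Rightarrow>\<^sub>C 'a"
    using continuous_on_compose2[OF lipschitz_on_continuous_on[OF lip]]
      continuous_on_apply_bcontfun by blast
  \<comment> \<open>Freezing the upper limit of the Picard integral outside \<open>{b..b + h}\<close> keeps it bounded on
    the whole line, so that the complete space of bounded continuous functions can be used.\<close>
  define T where "T \<phi> t = p + integral {b..cl t} (\<lambda>s. G (apply_bcontfun \<phi> s))"
    for \<phi> :: "real \<Rightarrow>\<^sub>C 'a" and t
  have T_mem: "T \<phi> \<in> bcontfun" for \<phi>
  proof -
    have "continuous_on {b..b + h} (\<lambda>t. integral {b..t} (\<lambda>s. G (apply_bcontfun \<phi> s)))"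
      by (intro indefinite_integral_continuous_1 integrable_continuous_real contG)
    moreover have "continuous_on UNIV cl"
      unfolding cl_def by (intro continuous_intros)
    ultimately have "continuous_on UNIV (\<lambda>t. integral {b..cl t} (\<lambda>s. G (apply_bcontfun \<phi> s)))"
      by (rule continuous_on_compose2) (use cl(1) in blast)
    then have ct: "continuous_on UNIV (T \<phi>)"
      unfolding T_def by (intro continuous_on_add continuous_on_const)
    have "range (T \<phi>) \<subseteq> T \<phi> ` {b..b + h}"
    proof
      fix z assume "z \<in> range (T \<phi>)"
      then obtain t where "z = T \<phi> t" by auto
      also have "T \<phi> t = T \<phi> (cl t)" using cl by (simp add: T_def)
      finally show "z \<in> T \<phi> ` {b..b + h}" using cl(1) by blast
    qed
    moreover have "bounded (T \<phi> ` {b..b + h})"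
      by (intro compact_imp_bounded compact_continuous_image continuous_on_subset[OF ct]) auto
    ultimately show ?thesis using ct bounded_subset by (auto simp: bcontfun_def)
  qed
  define \<Phi> where "\<Phi> \<phi> = Bcontfun (T \<phi>)" for \<phi>
  have ap: "apply_bcontfun (\<Phi> \<phi>) = T \<phi>" for \<phi>
    using T_mem by (simp add: \<Phi>_def Bcontfun_inverse)
  have "dist (\<Phi> \<phi>) (\<Phi> \<psi>) \<le> 1 / 2 * dist \<phi> \<psi>" for \<phi> \<psi>
  proof (rule dist_bound)
    fix t
    have ct: "cl t - b \<le> h" "b \<le> cl t" using cl(1)[of t] by auto
    have "dist (\<Phi> \<phi> t) (\<Phi> \<psi> t) =
      norm (integral {b..cl t} (\<lambda>s. G (\<phi> s) - G (\<psi> s)))"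
      unfolding ap T_def dist_norm
      by (subst integral_diff) (auto intro!: integrable_continuous_real contG)
    also have "\<dots> \<le> (L * dist \<phi> \<psi>) * (cl t - b)"
    proof (intro integral_bound continuous_intros contG)
      fix s
      have "norm (G (\<phi> s) - G (\<psi> s)) \<le> L * dist (\<phi> s) (\<psi> s)"
        using lipschitz_onD[OF lip] by (simp add: dist_norm)
      also have "\<dots> \<le> L * dist \<phi> \<psi>" by (intro mult_left_mono dist_bounded L0)
      finally show "norm (G (\<phi> s) - G (\<psi> s)) \<le> L * dist \<phi> \<psi>" .
    qed (use ct in auto)
    also have "\<dots> \<le> (L * dist \<phi> \<psi>) * h"
      using L0 ct by (intro mult_left_mono) auto
    also have "\<dots> = (L * h) * dist \<phi> \<psi>" by simp
    also have "\<dots> \<le> 1 / 2 * dist \<phi> \<psi>" by (intro mult_right_mono hL) auto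
    finally show "dist (\<Phi> \<phi> t) (\<Phi> \<psi> t) \<le> 1 / 2 * dist \<phi> \<psi>" .
  qed
  then have "\<exists>!\<phi>. \<Phi> \<phi> = \<phi>" by (intro banach_fix_type[of "1/2"]) auto
  then obtain \<phi> where "\<Phi> \<phi> = \<phi>" by blast
  with ap have fp: "apply_bcontfun \<phi> t = T \<phi> t" for t by metis
  show thesis
  proof (rule that[of h "apply_bcontfun \<phi>"])
    show "\<phi> b = p" using cl(2)[of b] h0 by (subst fp) (simp add: T_def)
    have eq: "\<phi> s = p + integral {b..s} (\<lambda>s. G (\<phi> s))" if "s \<in> {b..b + h}" for s
      using cl(2)[OF that] by (subst fp) (simp add: T_def)
    fix t assume t: "t \<in> {b..b + h}"
    have "((\<lambda>u. p + integral {b..u} (\<lambda>s. G (\<phi> s))) has_vector_derivative 0 + G (\<phi> t))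
        (at t within {b..b + h})"
      using t by (intro derivative_intros integral_has_vector_derivative contG)
    then show "(apply_bcontfun \<phi> has_vector_derivative G (\<phi> t)) (at t within {b..b + h})"
      using has_vector_derivative_transform[OF t eq] by simp
  qed (rule h0)
qed

text \<open>Composing \<open>F\<close> with the nearest-point projection onto the ball, which is
  1-Lipschitz, gives a globally Lipschitz field with the same constant. Its solution starts at the
  centre, so for a short time it stays in the ball, where the projection is the identity.\<close>

lemma local_solution_right:
  fixes F :: "'a::euclidean_space \<Rightarrow> 'a"
  assumes "r > 0" and lip: "L-lipschitz_on (cball p r) F"
  obtains h y where "h > 0" "y b = p"
    "\<And>t. t \<in> {b..b + h} \<Longrightarrow> (y has_vector_derivative F (y t)) (at t within {b..b + h})"
proof -
  define \<pi> where "\<pi> = closest_point (cball p r)"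
  have "1-lipschitz_on UNIV \<pi>"
    unfolding \<pi>_def using \<open>r > 0\<close>
    by (intro lipschitz_onI) (auto intro!: closest_point_lipschitz)
  moreover have "range \<pi> \<subseteq> cball p r"
    unfolding \<pi>_def using \<open>r > 0\<close> closest_point_in_set[of "cball p r"] by fastforce
  ultimately have "L-lipschitz_on UNIV (\<lambda>q. F (\<pi> q))"
    using lipschitz_on_compose2[of 1 UNIV \<pi> L F] lipschitz_on_subset[OF lip] by simp
  then obtain h y where h: "h > 0" and yb: "y b = p" and
    y: "\<And>t. t \<in> {b..b + h} \<Longrightarrow> (y has_vector_derivative F (\<pi> (y t))) (at t within {b..b + h})"
    using picard_lindelof_right[of L "\<lambda>q. F (\<pi> q)" b p] by blast
  have "continuous_on {b..b + h} y"
    using y has_vector_derivative_continuous continuous_on_eq_continuous_within by blast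
  then obtain d where d: "d > 0"
    "\<And>t. t \<in> {b..b + h} \<Longrightarrow> dist t b < d \<Longrightarrow> dist (y t) p < r"
    using \<open>r > 0\<close> h yb unfolding continuous_on_iff by (metis atLeastAtMost_iff less_add_same_cancel1 less_eq_real_def)
  show thesis
  \<comment> \<open>Halving \<open>d\<close> turns the strict condition \<open>dist t b < d\<close>
    into one that also holds at the right endpoint.\<close>
  proof (rule that[of "min h (d / 2)" y])
    fix t assume t: "t \<in> {b..b + min h (d / 2)}"
    then have t': "t \<in> {b..b + h}" by auto
    have "dist (y t) p < r" using d t t' by (intro d(2)) (auto simp: dist_real_def)
    then have "\<pi> (y t) = y t"
      unfolding \<pi>_def by (intro closest_point_self) (auto simp: dist_commute)
    with y[OF t'] have "(y has_vector_derivative F (y t)) (at t within {b..b + h})" by simp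
    then show "(y has_vector_derivative F (y t)) (at t within {b..b + min h (d / 2)})"
      by (rule has_vector_derivative_within_subset) auto
  qed (use h d yb in auto)
qed

lemma has_vector_derivative_within_Un:
  assumes "(f has_vector_derivative f') (at x within S)"
    and "(f has_vector_derivative f') (at x within T)"
  shows "(f has_vector_derivative f') (at x within S \<union> T)"
  using assms unfolding has_vector_derivative_def has_derivative_within
  by (auto intro: Lim_Un)

text \<open>A bounded solution has bounded velocity, hence is Lipschitz in time and extends
  continuously to the closed interval. The integral equation passes to the endpoint and yields the
  one-sided derivative there.\<close>

lemma bounded_solution_extends_to_endpoint:
  fixes F :: "'a::euclidean_space \<Rightarrow> 'a" and b :: real
  assumes x: "\<And>t. t \<in> {0..<b} \<Longrightarrow> (x has_vector_derivative F (x t)) (at t)"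
    and contF: "continuous_on UNIV F"
    and R: "\<And>t. t \<in> {0..<b} \<Longrightarrow> norm (x t) \<le> R"
    and "b > 0"
  obtains g where "\<And>t. t \<in> {0..<b} \<Longrightarrow> g t = x t"
    "(g has_vector_derivative F (g b)) (at b within {0..b})"
proof -
  have "compact (F ` cball 0 R)"
    by (intro compact_continuous_image continuous_on_subset[OF contF]) auto
  then obtain M where M0: "M > 0" and M: "\<And>q. q \<in> cball 0 R \<Longrightarrow> norm (F q) \<le> M"
    using compact_imp_bounded bounded_pos by (metis imageI)
  have "M-lipschitz_on {0..<b} x"
  proof (rule lipschitz_onI)
    fix s t assume st: "s \<in> {0..<b}" "t \<in> {0..<b}"
    have "norm (x s - x t) \<le> M * norm (s - t)"
    proof (rule differentiable_bound[OF _ _ _ st])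
      fix \<tau> assume \<tau>: "\<tau> \<in> {0..<b}"
      show "(x has_derivative (\<lambda>h. h *\<^sub>R F (x \<tau>))) (at \<tau> within {0..<b})"
        using x[OF \<tau>] unfolding has_vector_derivative_def by (rule has_derivative_at_withinI)
      have "norm (F (x \<tau>)) \<le> M" using R[OF \<tau>] by (intro M) simp
      then show "onorm (\<lambda>h. h *\<^sub>R F (x \<tau>)) \<le> M"
        by (intro onorm_le) (simp add: mult.commute[of M] mult_left_mono)
    qed simp
    then show "dist (x s) (x t) \<le> M * dist s t" by (simp only: dist_norm)
  qed (use M0 in simp)
  then obtain g where "M-lipschitz_on (closure {0..<b}) g" and g: "\<And>t. t \<in> {0..<b} \<Longrightarrow> g t = x t"
    using lipschitz_extend_closure by blast
  then have contg: "continuous_on {0..b} g"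
    using lipschitz_on_continuous_on \<open>b > 0\<close> by fastforce
  have contFg: "continuous_on {0..b} (\<lambda>t. F (g t))"
    using continuous_on_compose2[OF contF contg] by auto
  \<comment> \<open>The interior form of the fundamental theorem asks only for continuity at the
    ends, so \<open>t = b\<close> is covered although differentiability at \<open>b\<close> is still
    unknown.\<close>
  have ftc: "((\<lambda>s. F (g s)) has_integral g t - g 0) {0..t}" if t: "t \<in> {0..b}" for t
  proof (rule fundamental_theorem_of_calculus_interior)
    fix s assume s: "s \<in> {0<..<t}"
    with t have "s \<in> {0<..<b}" by auto
    then show "(g has_vector_derivative F (g s)) (at s)"
      using x[of s] g by (intro has_vector_derivative_transform_within_open[of x _ s "{0<..<b}" g]) auto
  qed (use t in \<open>auto intro: continuous_on_subset[OF contg]\<close>)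
  have gi: "g t = g 0 + integral {0..t} (\<lambda>s. F (g s))" if "t \<in> {0..b}" for t
    using integral_unique[OF ftc[OF that]] by simp
  have b: "b \<in> {0..b}" using \<open>b > 0\<close> by auto
  have "((\<lambda>t. g 0 + integral {0..t} (\<lambda>s. F (g s))) has_vector_derivative 0 + F (g b)) (at b within {0..b})"
    using b by (intro derivative_intros integral_has_vector_derivative contFg)
  then have "(g has_vector_derivative F (g b)) (at b within {0..b})"
    using has_vector_derivative_transform[OF b gi] by simp
  with g that show thesis by metis
qed

text \<open>If \<open>I\<close> ended at a finite time \<open>b\<close>, the orbit would have a
  limit there, and a local solution started from that limit would continue it past \<open>b\<close>,
  contradicting maximality.\<close>

lemma bounded_maximal_orbit_global:
  assumes lip: "\<And>p. \<exists>r>0. \<exists>L. L-lipschitz_on (cball p r) F"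
    and orbit: "maximal_orbit_from F q I x"
    and R: "\<And>t. t \<in> I \<Longrightarrow> 0 \<le> t \<Longrightarrow> norm (x t) \<le> R"
  shows "{0..} \<subseteq> I"
proof (rule ccontr)
  assume "\<not> {0..} \<subseteq> I"
  then obtain s where s: "s \<ge> 0" "s \<notin> I" by auto
  from orbit have I: "0 \<in> I" "open I" "is_interval I"
    and x: "\<And>t. t \<in> I \<Longrightarrow> (x has_vector_derivative F (x t)) (at t)"
    and maxi: "\<And>J z. solves_ode F J z \<Longrightarrow> I \<subseteq> J \<Longrightarrow> (\<And>t. t \<in> I \<Longrightarrow> z t = x t) \<Longrightarrow> J = I"
    unfolding maximal_orbit_from_def solves_ode_def by blast+
  have Iab: "t \<in> I" if "a \<in> I" "b \<in> I" "a \<le> t" "t \<le> b" for a b t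
    using I(3) that unfolding is_interval_1 by blast
  have ub: "t \<le> s" if "t \<in> I" for t using Iab[OF I(1) that s(1)] s(2) by linarith
  define b where "b = Sup I"
  have bdd: "bdd_above I" using ub by (rule bdd_aboveI)
  have Ib: "t \<le> b" if "t \<in> I" for t unfolding b_def using bdd that by (rule cSup_upper[rotated])
  have bI: "b \<notin> I"
  proof
    assume "b \<in> I"
    then obtain e where "e > 0" "cball b e \<subseteq> I" using I(2) open_contains_cball by blast
    then have "b + e \<in> I" by (auto simp: subset_iff dist_real_def)
    with Ib \<open>e > 0\<close> show False by force
  qed
  have Ilt: "t < b" if "t \<in> I" for t using Ib[OF that] bI that by (cases "t = b") auto
  have b0: "b > 0" using Ilt I(1) by blast
  have bsub: "t \<in> I" if t: "0 \<le> t" "t < b" for t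
  proof -
    obtain t' where "t' \<in> I" "t < t'"
      using t I(1) less_cSup_iff[of I t] bdd unfolding b_def by blast
    then show ?thesis using Iab[OF I(1), of t' t] t by linarith
  qed
  have contF: "continuous_on UNIV F"
  proof (rule continuous_at_imp_continuous_on, rule)
    fix p
    obtain r L where "r > 0" "L-lipschitz_on (cball p r) F" using lip by blast
    then show "isCont F p"
      by (metis centre_in_ball ball_subset_cball continuous_on_interior interior_cball lipschitz_on_continuous_on)
  qed
  obtain g where g: "\<And>t. t \<in> {0..<b} \<Longrightarrow> g t = x t"
    "(g has_vector_derivative F (g b)) (at b within {0..b})"
    using bounded_solution_extends_to_endpoint[of b x F R] x R bsub contF b0 by auto
  obtain r L where "r > 0" "L-lipschitz_on (cball (g b) r) F" using lip by blast
  then obtain h y where h: "h > 0" and yb: "y b = g b" and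
    y: "\<And>t. t \<in> {b..b + h} \<Longrightarrow> (y has_vector_derivative F (y t)) (at t within {b..b + h})"
    using local_solution_right[of r L "g b" F b] by blast
  \<comment> \<open>As a union of two overlapping open intervals, \<open>J\<close> is visibly open
    and connected; \<open>Jle\<close> gives the form suited to comparing \<open>t\<close> with
    \<open>b\<close>.\<close>
  define J where "J = I \<union> {0<..<b + h}"
  define z where "z t = (if t < b then x t else y t)" for t
  have Jle: "J = I \<union> {b..<b + h}"
    unfolding J_def using bsub b0 I(1) by force
  have "b / 2 \<in> I \<inter> {0<..<b + h}" using b0 h bsub[of "b / 2"] by simp
  then have "is_interval J"
    unfolding J_def is_interval_connected_1
    using I(3) by (intro connected_Un) (auto simp: is_interval_connected_1)
  moreover have "open J" unfolding J_def using I(2) by auto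
  moreover have "(z has_vector_derivative F (z t)) (at t)" if "t \<in> J" for t
  proof (cases t b rule: linorder_cases)
    case less
    with that have "t \<in> I" unfolding Jle by auto
    then have "(z has_vector_derivative F (x t)) (at t)"
      using less by (intro has_vector_derivative_transform_within_open[OF x open_lessThan[of b]])
        (auto simp: z_def)
    with less show ?thesis by (simp add: z_def)
  next
    case greater
    with that Ilt have t: "t \<in> {b<..<b + h}" unfolding Jle by force
    then have "(y has_vector_derivative F (y t)) (at t within {b<..<b + h})"
      by (intro has_vector_derivative_within_subset[OF y]) auto
    then have "(y has_vector_derivative F (y t)) (at t)" by (simp only: at_within_open[OF t open_greaterThanLessThan])
    then have "(z has_vector_derivative F (y t)) (at t)"
      by (rule has_vector_derivative_transform_within_open[OF _ open_greaterThanLessThan t])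
        (simp add: z_def)
    with t show ?thesis by (simp add: z_def)
  next
    case equal
    \<comment> \<open>At the junction the left derivative comes from \<open>g\<close> and the right
      one from \<open>y\<close>. Both equal \<open>F (z b)\<close>, so they combine into a two-sided
      derivative.\<close>
    have zg: "z t = g t" if "t \<in> {0..b}" for t using g(1)[of t] that yb by (auto simp: z_def)
    have "(z has_vector_derivative F (z b)) (at b within {0..b})"
      using has_vector_derivative_transform[OF _ zg g(2)] zg[of b] b0 by auto
    moreover have "(z has_vector_derivative F (z b)) (at b within {b..b + h})"
      using has_vector_derivative_transform[OF _ _ y, of b z] h by (auto simp: z_def)
    ultimately have "(z has_vector_derivative F (z b)) (at b within {0..b} \<union> {b..b + h})"
      by (rule has_vector_derivative_within_Un)
    then have "(z has_vector_derivative F (z b)) (at b within {0<..<b + h})"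
      by (rule has_vector_derivative_within_subset) auto
    moreover have "b \<in> {0<..<b + h}" using b0 h by simp
    ultimately have "(z has_vector_derivative F (z b)) (at b)"
      by (simp only: at_within_open[OF _ open_greaterThanLessThan])
    with equal show ?thesis by simp
  qed
  ultimately have "solves_ode F J z" by (simp add: solves_ode_def)
  moreover have "I \<subseteq> J" "\<And>t. t \<in> I \<Longrightarrow> z t = x t" using Ilt by (auto simp: J_def z_def)
  ultimately have "J = I" by (rule maxi)
  moreover have "b \<in> J" using h b0 by (auto simp: Jle)
  ultimately show False using bI by simp
qed

subsection \<open>Time reversal\<close>

text \<open>By the chain rule, reversing time contributes the sign in \<open>GF\<close>. Since
  \<open>R\<close> is an involution, the relation between \<open>F\<close> and \<open>G\<close> is
  symmetric: an extension of the reversed orbit reverses to an extension of \<open>x\<close>, which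
  transfers maximality.\<close>

lemma maximal_orbit_from_reverse:
  assumes R: "bounded_linear R" "\<And>p. R (R p) = p"
    and GF: "\<And>p. G (R p) = - R (F p)"
    and orbit: "maximal_orbit_from F q I x"
  shows "maximal_orbit_from G (R q) (uminus ` I) (\<lambda>t. R (x (- t)))"
proof -
  have FG: "F (R p) = - R (G p)" for p
    using GF[of "R p"] R(2) bounded_linear.linear[OF R(1), THEN linear_neg] by simp
  \<comment> \<open>The fields are kept arbitrary because the reversal is used in both directions:
    from \<open>F\<close> to \<open>G\<close> for the orbit, from \<open>G\<close> to
    \<open>F\<close> for competing extensions.\<close>
  have rev: "solves_ode H (uminus ` J) (\<lambda>t. R (z (- t)))"
    if z: "solves_ode K J z" and HK: "\<And>p. H (R p) = - R (K p)" for H K J z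
  proof -
    have "((\<lambda>t. R (z (- t))) has_vector_derivative H (R (z (- t)))) (at t)" if "- t \<in> J" for t
    proof -
      have "(z has_vector_derivative K (z (- t))) (at (- t))"
        using z that by (simp add: solves_ode_def)
      then have "((z \<circ> uminus) has_vector_derivative (-1) *\<^sub>R K (z (- t))) (at t)"
        by (intro vector_diff_chain_at) (auto intro!: derivative_eq_intros)
      then have "((\<lambda>t. R ((z \<circ> uminus) t)) has_vector_derivative R ((-1) *\<^sub>R K (z (- t)))) (at t)"
        by (rule bounded_linear.has_vector_derivative[OF R(1)])
      then show ?thesis
        using bounded_linear.linear[OF R(1), THEN linear_neg] by (simp add: HK o_def)
    qed
    then have "((\<lambda>t. R (z (- t))) has_vector_derivative H (R (z (- t)))) (at t)"
      if t: "t \<in> uminus ` J" for t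
      using t by (metis imageE minus_minus)
    then show ?thesis
      using z unfolding solves_ode_def by (auto intro: open_negations)
  qed
  have x: "0 \<in> I" "x 0 = q" "solves_ode F I x"
    and maxi: "\<And>J z. solves_ode F J z \<Longrightarrow> I \<subseteq> J \<Longrightarrow> (\<And>t. t \<in> I \<Longrightarrow> z t = x t) \<Longrightarrow> J = I"
    using orbit unfolding maximal_orbit_from_def by blast+
  show ?thesis
    unfolding maximal_orbit_from_def
  proof (intro conjI allI impI)
    fix J z
    assume J: "solves_ode G J z \<and> uminus ` I \<subseteq> J \<and> (\<forall>t\<in>uminus ` I. z t = R (x (- t)))"
    have "uminus ` J = I"
    proof (rule maxi)
      show "solves_ode F (uminus ` J) (\<lambda>t. R (z (- t)))"
        using J rev[of G J z F] FG by blast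
      show "I \<subseteq> uminus ` J" using J by force
      show "R (z (- t)) = x t" if "t \<in> I" for t using J that R(2) by auto
    qed
    then show "J = uminus ` I" by (force simp: image_image)
  next
    show "solves_ode G (uminus ` I) (\<lambda>t. R (x (- t)))" using rev[OF x(3)] GF by blast
  qed (use x in \<open>auto simp: image_iff\<close>)
qed

text \<open>A linear isometric involution preserves distances, zeros and unit directions, so only
  the direction of time changes.\<close>

lemma unstable_node_reverse:
  assumes R: "linear R" "\<And>p. R (R p) = p" "\<And>p. norm (R p) = norm p"
    and GF: "\<And>p. G (R p) = - R (F p)"
    and node: "stable_node G (R p)"
  shows "unstable_node F p"
proof -
  have bl: "bounded_linear R" using R(1) by (rule linear_linear[THEN iffD2])
  have dist: "dist (R a) (R b) = dist a b" for a b
    using R(3)[of "a - b"] linear_diff[OF R(1)] by (simp add: dist_norm)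
  have zero: "F a = 0 \<longleftrightarrow> G (R a) = 0" for a
    using GF[of a] R(3)[of "F a"] by (metis neg_equal_0_iff_equal norm_eq_zero)
  have "isolated_critical_point F p"
    using node unfolding stable_node_def isolated_critical_point_def
    by (metis R(2) dist zero)
  moreover obtain e where "e > 0" and e: "\<And>q I x. q \<noteq> R p \<Longrightarrow> dist q (R p) < e \<Longrightarrow>
      maximal_orbit_from G q I x \<Longrightarrow> {0..} \<subseteq> I \<and> tends_with_tangent x (R p) at_top"
    using node unfolding stable_node_def by blast
  moreover have "{..0} \<subseteq> I \<and> tends_with_tangent x p at_bot"
    if q: "q \<noteq> p" "dist q p < e" and orbit: "maximal_orbit_from F q I x" for q I x
  proof -
    let ?y = "\<lambda>t. R (x (- t))"
    have "maximal_orbit_from G (R q) (uminus ` I) ?y"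
      using bl R(2) GF orbit by (rule maximal_orbit_from_reverse)
    moreover have "R q \<noteq> R p" using q(1) R(2) by metis
    ultimately have I: "{0..} \<subseteq> uminus ` I" and y: "tends_with_tangent ?y (R p) at_top"
      using e[of "R q"] q(2) dist by auto
    have "{..0} \<subseteq> I"
    proof
      fix t :: real assume "t \<in> {..0}"
      then have "- t \<in> uminus ` I" using I by auto
      then show "t \<in> I" by auto
    qed
    moreover have "tends_with_tangent x p at_bot"
    proof -
      obtain w where lim: "(?y \<longlongrightarrow> R p) at_top" and "norm w = 1"
        and w: "((\<lambda>t. sgn (?y t - R p)) \<longlongrightarrow> w) at_top"
        using y unfolding tends_with_tangent_def by blast
      have "((\<lambda>t. R (?y (- t))) \<longlongrightarrow> R (R p)) at_bot"
        using filterlim_compose[OF lim filterlim_uminus_at_top_at_bot]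
        by (rule bounded_linear.tendsto[OF bl])
      then have "(x \<longlongrightarrow> p) at_bot" by (simp add: R(2))
      \<comment> \<open>A linear isometry commutes with normalisation, so \<open>R\<close> carries
        the tangent direction of the reversed orbit back to that of \<open>x\<close>.\<close>
      moreover have "R (sgn (R a - R p)) = sgn (a - p)" for a
      proof -
        have "R (sgn (R a - R p)) = R (sgn (R (a - p)))" by (simp add: linear_diff[OF R(1)])
        also have "\<dots> = sgn (a - p)" by (simp add: sgn_div_norm linear_scale[OF R(1)] R(2,3))
        finally show ?thesis .
      qed
      moreover have "((\<lambda>t. R (sgn (?y (- t) - R p))) \<longlongrightarrow> R w) at_bot"
        using filterlim_compose[OF w filterlim_uminus_at_top_at_bot]
        by (rule bounded_linear.tendsto[OF bl])
      moreover have "norm (R w) = 1" using \<open>norm w = 1\<close> R(3) by simp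
      ultimately show ?thesis
        unfolding tends_with_tangent_def by (intro conjI exI[of _ "R w"]) (simp_all add: R(2))
    qed
    ultimately show ?thesis ..
  qed
  ultimately show ?thesis unfolding unstable_node_def by blast
qed

subsection \<open>The chart at infinity\<close>

lemma bipoly_deg_le_y: "bipoly_deg_le 2 (\<lambda>x y. y)"
  unfolding bipoly_deg_le_def
  by (rule exI[of _ "\<lambda>i j. if i = 0 \<and> j = 1 then 1 else 0"])
    (simp add: numeral_2_eq_2)

lemma bipoly_deg_le_square: "bipoly_deg_le 2 (\<lambda>x y. - c * x ^ 2)"
  unfolding bipoly_deg_le_def
  by (rule exI[of _ "\<lambda>i j. if i = 2 \<and> j = 0 then - c else 0"])
    (simp add: numeral_2_eq_2)

lemma bipoly_deg_le_squareD:
  assumes "c \<noteq> 0" and "bipoly_deg_le d (\<lambda>x y. - c * x ^ 2)"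
  shows "2 \<le> d"
proof -
  from assms(2) obtain a where a: "\<And>x y. - c * x ^ 2 = (\<Sum>i\<le>d. \<Sum>j\<le>d - i. a i j * x ^ i * y ^ j)"
    unfolding bipoly_deg_le_def by blast
  show "2 \<le> d"
  proof (rule ccontr)
    assume "\<not> 2 \<le> d"
    then have "d = 0 \<or> d = 1" by linarith
    \<comment> \<open>Setting \<open>y = 0\<close> leaves only the terms with \<open>j = 0\<close>,
      since \<open>0 ^ 0 = 1\<close>. The values at 0, 1 and -1 then show that no affine function
      equals this quadratic.\<close>
    then have "- c * x ^ 2 = a 0 0 + (if d = 1 then a 1 0 * x else 0)" for x
      using a[of x 0] by auto
    from this[of 0] this[of 1] this[of "-1"] \<open>c \<noteq> 0\<close> show False by (auto split: if_splits)
  qed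
qed

lemma vf_degree_quadratic:
  assumes "c \<noteq> 0"
  shows "vf_degree (\<lambda>x y. y) (\<lambda>x y. - c * x ^ 2) = 2"
  unfolding vf_degree_def
  using bipoly_deg_le_y bipoly_deg_le_square bipoly_deg_le_squareD[OF assms] by (intro Least_equality) auto

text \<open>The complement of the line at infinity is dense, so a continuous field that agrees with
  the formula there also supplies the limit defining the chart on that line.\<close>

lemma chart_U2_eq_continuous:
  assumes eq: "\<And>u v. v \<noteq> 0 \<Longrightarrow> chart_U2_formula P Q (u, v) = F (u, v)"
    and cont: "\<And>p. isCont F p"
  shows "chart_U2 P Q = F"
proof
  fix p :: "real \<times> real"
  show "chart_U2 P Q p = F p"
  proof (cases "snd p = 0")
    case False
    then show ?thesis using eq[of "snd p" "fst p"] by (simp add: chart_U2_def)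
  next
    case True
    have "p islimpt {q. snd q \<noteq> 0}"
      unfolding islimpt_approachable
    proof (intro allI impI)
      fix e :: real assume "e > 0"
      then show "\<exists>q\<in>{q. snd q \<noteq> 0}. q \<noteq> p \<and> dist q p < e"
        using True
        by (intro bexI[of _ "(fst p, e / 2)"]) (auto simp: dist_prod_def dist_real_def prod_eq_iff)
    qed
    then have "at p within {q. snd q \<noteq> 0} \<noteq> bot" by (simp add: trivial_limit_within)
    moreover have "(F \<longlongrightarrow> F p) (at p within {q. snd q \<noteq> 0})"
      using cont[of p] by (auto simp: isCont_def intro: tendsto_within_subset)
    then have "(chart_U2_formula P Q \<longlongrightarrow> F p) (at p within {q. snd q \<noteq> 0})"
      by (rule Lim_transform_eventually)
        (auto simp: eventually_at_filter eq split_paired_all intro!: always_eventually)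
    ultimately show ?thesis using True by (simp add: chart_U2_def tendsto_Lim)
  qed
qed

definition cubic_field :: "real \<Rightarrow> real \<times> real \<Rightarrow> real \<times> real" where
  "cubic_field c = (\<lambda>(u, v). (v + c * u ^ 3, c * u ^ 2 * v))"

lemma chart_U2_cubic_field:
  assumes "c \<noteq> 0"
  shows "chart_U2 (\<lambda>x y. y) (\<lambda>x y. - c * x ^ 2) = cubic_field c"
proof (rule chart_U2_eq_continuous)
  fix u v :: real assume "v \<noteq> 0"
  then show "chart_U2_formula (\<lambda>x y. y) (\<lambda>x y. - c * x ^ 2) (u, v) = cubic_field c (u, v)"
    unfolding chart_U2_formula_def vf_degree_quadratic[OF assms] cubic_field_def
    by (simp add: field_simps power2_eq_square power3_eq_cube)
next
  show "isCont (cubic_field c) p" for p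
    unfolding cubic_field_def case_prod_unfold by (intro continuous_intros)
qed

subsection \<open>Orbits of the cubic field\<close>

text \<open>Adding and subtracting \<open>f p * g q\<close> splits the increment of the product.
  This builds the monomials of the cubic field from the coordinates, which are bounded on a
  ball.\<close>

lemma lipschitz_on_mult:
  fixes f g :: "'a::metric_space \<Rightarrow> real"
  assumes f: "L-lipschitz_on X f" "\<And>p. p \<in> X \<Longrightarrow> \<bar>f p\<bar> \<le> A"
    and g: "M-lipschitz_on X g" "\<And>p. p \<in> X \<Longrightarrow> \<bar>g p\<bar> \<le> B"
    and "A \<ge> 0" "B \<ge> 0"
  shows "(A * M + L * B)-lipschitz_on X (\<lambda>p. f p * g p)"
proof (rule lipschitz_onI)
  fix p q assume pq: "p \<in> X" "q \<in> X"
  have "f p * g p - f q * g q = f p * (g p - g q) + (f p - f q) * g q"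
    by (simp add: algebra_simps)
  then have "\<bar>f p * g p - f q * g q\<bar> \<le> \<bar>f p\<bar> * \<bar>g p - g q\<bar> + \<bar>f p - f q\<bar> * \<bar>g q\<bar>"
    by (metis abs_mult abs_triangle_ineq)
  also have "\<dots> \<le> A * (M * dist p q) + (L * dist p q) * B"
    using pq assms lipschitz_onD[OF f(1) pq] lipschitz_onD[OF g(1) pq] lipschitz_on_nonneg[OF f(1)]
    by (intro add_mono mult_mono) (auto simp: dist_real_def)
  finally show "dist (f p * g p) (f q * g q) \<le> (A * M + L * B) * dist p q"
    by (simp add: dist_real_def algebra_simps)
next
  show "0 \<le> A * M + L * B"
    using assms(5,6) lipschitz_on_nonneg[OF f(1)] lipschitz_on_nonneg[OF g(1)] by simp
qed

lemma cubic_field_locally_lipschitz: "\<exists>r>0. \<exists>L. L-lipschitz_on (cball p r) (cubic_field c)"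
proof -
  define X where "X = cball p 1"
  obtain B where B: "B > 0" "\<And>q. q \<in> X \<Longrightarrow> norm q \<le> B"
    using bounded_cball bounded_pos unfolding X_def by metis
  have le: "\<bar>fst q\<bar> \<le> B" "\<bar>snd q\<bar> \<le> B" if "q \<in> X" for q
    using B(2)[OF that] norm_fst_le[of "fst q" "snd q"] norm_snd_le[of "snd q" "fst q"] by auto
  have u: "1-lipschitz_on X (fst :: real \<times> real \<Rightarrow> real)"
    and v: "1-lipschitz_on X (snd :: real \<times> real \<Rightarrow> real)"
    by (intro lipschitz_onI; simp add: dist_fst_le dist_snd_le)+
  obtain L2 where u2: "L2-lipschitz_on X (\<lambda>q. fst q * fst q)"
    using lipschitz_on_mult[OF u le(1) u le(1)] B(1) by auto
  have le2: "\<bar>fst q * fst q\<bar> \<le> B * B" if "q \<in> X" for q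
    using le(1)[OF that] B(1) unfolding abs_mult by (intro mult_mono) auto
  obtain L3 where u3: "L3-lipschitz_on X (\<lambda>q. fst q * fst q * fst q)"
    using lipschitz_on_mult[OF u2 le2 u le(1)] B(1) by auto
  obtain L where uv: "L-lipschitz_on X (\<lambda>q. fst q * fst q * snd q)"
    using lipschitz_on_mult[OF u2 le2 v le(2)] B(1) by auto
  have "\<exists>K. K-lipschitz_on X
      (\<lambda>q. (snd q + c * (fst q * fst q * fst q), c * (fst q * fst q * snd q)))"
    using lipschitz_on_Pair[OF lipschitz_on_add[OF v lipschitz_on_cmult_real[OF u3]]
      lipschitz_on_cmult_real[OF uv]] by blast
  also have "(\<lambda>q. (snd q + c * (fst q * fst q * fst q), c * (fst q * fst q * snd q))) = cubic_field c"
    by (auto simp: cubic_field_def power3_eq_cube power2_eq_square)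
  finally show ?thesis unfolding X_def by (intro exI[of _ 1]) auto
qed

section \<open>Scalar linear equations, limits at infinity and tangent directions\<close>

text \<open>Integrating factor: the product of \<open>w\<close> with
  \<open>exp (- integral {0..s} g)\<close> has derivative zero.\<close>

lemma scalar_linear_ode_solution:
  fixes w g :: "real \<Rightarrow> real"
  assumes "0 \<le> t" and g: "continuous_on {0..t} g"
    and w: "\<And>s. s \<in> {0..t} \<Longrightarrow> (w has_real_derivative g s * w s) (at s)"
  shows "w t = w 0 * exp (integral {0..t} g)"
proof -
  define \<phi> where "\<phi> s = w s * exp (- integral {0..s} g)" for s
  have "(\<phi> has_real_derivative 0) (at s within {0..t})" if s: "s \<in> {0..t}" for s
  proof -
    have "((\<lambda>s. integral {0..s} g) has_real_derivative g s) (at s within {0..t})"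
      using integral_has_vector_derivative[OF g s]
      by (simp add: has_real_derivative_iff_has_vector_derivative)
    then have "(\<phi> has_real_derivative g s * w s * exp (- integral {0..s} g)
        + exp (- integral {0..s} g) * (- g s) * w s) (at s within {0..t})"
      unfolding \<phi>_def using has_field_derivative_at_within[OF w[OF s]]
      by (auto intro!: derivative_eq_intros)
    then show ?thesis by (simp add: algebra_simps)
  qed
  then have "\<exists>k. \<forall>s\<in>{0..t}. \<phi> s = k"
    by (intro has_field_derivative_zero_constant) auto
  then have "\<phi> t = \<phi> 0" using \<open>0 \<le> t\<close> by auto
  then show ?thesis by (simp add: \<phi>_def exp_minus field_simps)
qed

text \<open>By L'Hospital \<open>f t / t\<close> tends to \<open>m\<close>, while convergence of
  \<open>f\<close> makes it tend to 0. This serves to show that the limit of a convergent orbit is a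
  critical point.\<close>

lemma tendsto_deriv_at_top_eq_0:
  fixes f :: "real \<Rightarrow> real"
  assumes f: "(f \<longlongrightarrow> l) at_top" and f': "(f' \<longlongrightarrow> m) at_top"
    and der: "\<And>t. t \<ge> 0 \<Longrightarrow> (f has_real_derivative f' t) (at t)"
  shows "m = 0"
proof -
  have "((\<lambda>t. f t / t) \<longlongrightarrow> m) at_top"
  proof (rule lhospital_at_top_at_top)
    show "\<forall>\<^sub>F t in at_top. (f has_real_derivative f' t) (at t)"
      using eventually_ge_at_top[of 0] by eventually_elim (rule der)
    show "((\<lambda>t. f' t / 1) \<longlongrightarrow> m) at_top" using f' by simp
  qed (auto intro!: derivative_eq_intros filterlim_ident)
  moreover have "((\<lambda>t. f t / t) \<longlongrightarrow> 0) at_top"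
    using f filterlim_ident by (rule real_tendsto_divide_at_top)
  ultimately show ?thesis using tendsto_unique trivial_limit_at_top_linorder by blast
qed

text \<open>Factoring \<open>(u, v)\<close> as \<open>u\<close> times \<open>(1, v / u)\<close>
  shows that its direction is the sign of \<open>u\<close> times the normalised second factor, which
  tends to \<open>(1, 0)\<close>.\<close>

lemma tends_with_horizontal_tangent:
  assumes "(u \<longlongrightarrow> 0) T" "(v \<longlongrightarrow> 0) T" "\<bar>\<sigma>\<bar> = 1"
    and sgn: "\<forall>\<^sub>F t in T. sgn (u t) = \<sigma>"
    and slope: "((\<lambda>t. v t / u t) \<longlongrightarrow> 0) T"
  shows "tends_with_tangent (\<lambda>t. (u t, v t)) (0, 0) T"
  unfolding tends_with_tangent_def
proof (intro conjI exI)
  show "((\<lambda>t. (u t, v t)) \<longlongrightarrow> (0, 0)) T" using assms by (intro tendsto_Pair)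
  have "((\<lambda>t. sgn (1 :: real, v t / u t)) \<longlongrightarrow> sgn (1, 0)) T"
    using slope by (intro tendsto_sgn tendsto_Pair tendsto_const) (auto simp: zero_prod_def)
  then have "((\<lambda>t. \<sigma> *\<^sub>R sgn (1 :: real, v t / u t)) \<longlongrightarrow> \<sigma> *\<^sub>R sgn (1, 0)) T"
    by (intro tendsto_scaleR tendsto_const)
  moreover have "\<forall>\<^sub>F t in T. \<sigma> *\<^sub>R sgn (1, v t / u t) = sgn ((u t, v t) - (0, 0))"
    using sgn
  proof eventually_elim
    case (elim t)
    then have "u t \<noteq> 0" using \<open>\<bar>\<sigma>\<bar> = 1\<close> by auto
    then have "(u t, v t) - (0, 0) = u t *\<^sub>R (1, v t / u t)" by simp
    then show ?case using elim by (simp only: sgn_scaleR)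
  qed
  ultimately show "((\<lambda>t. sgn ((u t, v t) - (0, 0))) \<longlongrightarrow> \<sigma> *\<^sub>R sgn (1, 0)) T"
    by (rule Lim_transform_eventually)
  show "norm (\<sigma> *\<^sub>R sgn (1 :: real, 0 :: real)) = 1"
    using \<open>\<bar>\<sigma>\<bar> = 1\<close> by (simp add: norm_sgn zero_prod_def)
qed

section \<open>Explicit orbits in terms of the decay factor\<close>

text \<open>In the variables \<open>v\<close> and \<open>u ^ 3\<close> the field is linear up to the
  common factor \<open>u ^ 2\<close>, with eigenvalues \<open>c\<close> and \<open>3 * c\<close>.
  The left eigenvectors give \<open>v\<close> and \<open>3 * v + 2 * c * u ^ 3\<close>, so each
  solves a scalar linear equation.\<close>

lemma cubic_field_factor:
  assumes "0 \<le> t"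
    and u: "\<And>s. s \<in> {0..t} \<Longrightarrow> (u has_real_derivative v s + c * u s ^ 3) (at s)"
    and v: "\<And>s. s \<in> {0..t} \<Longrightarrow> (v has_real_derivative c * u s ^ 2 * v s) (at s)"
    and h: "h = exp (c * integral {0..t} (\<lambda>s. u s ^ 2))"
  shows "v t = v 0 * h"
    and "3 * v t + 2 * c * u t ^ 3 = (3 * v 0 + 2 * c * u 0 ^ 3) * h ^ 3"
proof -
  have contu: "continuous_on {0..t} u"
    using u by (meson DERIV_isCont continuous_at_imp_continuous_on)
  show "v t = v 0 * h"
    using scalar_linear_ode_solution[OF \<open>0 \<le> t\<close> continuous_on_mult_left[OF continuous_on_power[OF contu]] v]
    by (simp add: h)
  have "((\<lambda>s. 3 * v s + 2 * c * u s ^ 3) has_real_derivative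
      3 * c * u s ^ 2 * (3 * v s + 2 * c * u s ^ 3)) (at s)" if "s \<in> {0..t}" for s
    using u[OF that] v[OF that]
    by (auto intro!: derivative_eq_intros simp: algebra_simps power2_eq_square power3_eq_cube)
  then have "3 * v t + 2 * c * u t ^ 3 = (3 * v 0 + 2 * c * u 0 ^ 3) *
      exp (integral {0..t} (\<lambda>s. 3 * c * u s ^ 2))"
    by (intro scalar_linear_ode_solution[OF \<open>0 \<le> t\<close>, of "\<lambda>s. 3 * c * u s ^ 2"])
      (auto intro!: continuous_intros contu)
  also have "exp (integral {0..t} (\<lambda>s. 3 * c * u s ^ 2)) = h ^ 3"
    by (simp add: h flip: exp_of_nat_mult)
  finally show "3 * v t + 2 * c * u t ^ 3 = (3 * v 0 + 2 * c * u 0 ^ 3) * h ^ 3" .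
qed

text \<open>If \<open>u\<close> or \<open>v\<close> vanishes, as the second component demands, the
  first component forces the other to vanish. The origin is thus the only critical point of the
  plane, and the radius 1 is arbitrary.\<close>

lemma cubic_field_isolated:
  assumes "c \<noteq> 0"
  shows "isolated_critical_point (cubic_field c) (0, 0)"
  unfolding isolated_critical_point_def cubic_field_def zero_prod_def
  using assms by (auto intro!: exI[of _ 1])

lemma sgn_cube: "sgn (a ^ 3) = sgn (a :: real)"
  by (cases a "0 :: real" rule: linorder_cases) (auto simp: power3_eq_cube mult_neg_neg mult_pos_neg mult_neg_pos)

lemma cubic_field_orbit:
  assumes "c < 0" and orbit: "maximal_orbit_from (cubic_field c) q I x" and "q \<noteq> (0, 0)"
  shows "{0..} \<subseteq> I \<and> tends_with_tangent x (0, 0) at_top"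
proof -
  define u v where "u t = fst (x t)" and "v t = snd (x t)" for t
  have x: "x = (\<lambda>t. (u t, v t))" by (auto simp: u_def v_def)
  define w where "w = 3 * v 0 + 2 * c * u 0 ^ 3"
  define h where "h t = exp (c * integral {0..t} (\<lambda>s. u s ^ 2))" for t
  have I: "0 \<in> I" "is_interval I"
    and der: "\<And>t. t \<in> I \<Longrightarrow> (x has_vector_derivative cubic_field c (x t)) (at t)"
    using orbit by (auto simp: maximal_orbit_from_def solves_ode_def)
  have Isub: "{0..t} \<subseteq> I" if "t \<in> I" for t
    using I that unfolding is_interval_1 by (meson atLeastAtMost_iff subsetI)
  have du: "(u has_real_derivative v t + c * u t ^ 3) (at t)"
    and dv: "(v has_real_derivative c * u t ^ 2 * v t) (at t)" if "t \<in> I" for t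
    using bounded_linear.has_vector_derivative[OF bounded_linear_fst der[OF that]]
      bounded_linear.has_vector_derivative[OF bounded_linear_snd der[OF that]]
    by (auto simp: x cubic_field_def has_real_derivative_iff_has_vector_derivative)
  have vh: "v t = v 0 * h t"
    and uh: "u t ^ 3 = (w * h t ^ 3 - 3 * v 0 * h t) / (2 * c)" if "t \<in> I" "t \<ge> 0" for t
  proof -
    have d: "(u has_real_derivative v s + c * u s ^ 3) (at s)"
      "(v has_real_derivative c * u s ^ 2 * v s) (at s)" if "s \<in> {0..t}" for s
      using du[of s] dv[of s] that Isub[OF \<open>t \<in> I\<close>] by auto
    show v: "v t = v 0 * h t"
      using cubic_field_factor(1)[OF \<open>t \<ge> 0\<close> d h_def] .
    show "u t ^ 3 = (w * h t ^ 3 - 3 * v 0 * h t) / (2 * c)"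
      using cubic_field_factor(2)[OF \<open>t \<ge> 0\<close> d h_def] v \<open>c < 0\<close>
      by (simp add: w_def field_simps)
  qed
  have h0: "h t > 0" for t by (simp add: h_def)
  have int: "(\<lambda>s. u s ^ 2) integrable_on {0..t}" if "t \<in> I" for t
  proof -
    have "continuous_on {0..t} u"
      using du Isub[OF that] by (meson DERIV_isCont continuous_at_imp_continuous_on subsetD)
    then show ?thesis by (intro integrable_continuous_real continuous_on_power)
  qed
  have h_mono: "h t \<le> h s" if "0 \<le> s" "s \<le> t" "t \<in> I" for s t
  proof -
    have "s \<in> I" using Isub[OF that(3)] that by auto
    then have "integral {0..s} (\<lambda>s. u s ^ 2) \<le> integral {0..t} (\<lambda>s. u s ^ 2)"
      using that by (intro integral_subset_le int) auto
    then show ?thesis using \<open>c < 0\<close> by (simp add: h_def mult_left_mono_neg)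
  qed
  have h1: "h t \<le> 1" if "t \<in> I" "0 \<le> t" for t
    using h_mono[of 0 t] that by (simp add: h_def)
  have global: "{0..} \<subseteq> I"
  proof (rule bounded_maximal_orbit_global[OF cubic_field_locally_lipschitz orbit])
    fix t assume t: "t \<in> I" "0 \<le> t"
    let ?B = "(\<bar>w\<bar> + 3 * \<bar>v 0\<bar>) / (2 * \<bar>c\<bar>)"
    have v: "\<bar>v t\<bar> \<le> \<bar>v 0\<bar>"
      unfolding vh[OF t] abs_mult using h0[of t] h1[OF t] by (simp add: mult_left_le)
    have "\<bar>w * h t ^ 3\<bar> \<le> \<bar>w\<bar>"
      using h0[of t] h1[OF t] by (simp add: abs_mult mult_left_le power_le_one)
    moreover have "\<bar>3 * v 0 * h t\<bar> \<le> 3 * \<bar>v 0\<bar>"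
      using h0[of t] h1[OF t] by (simp add: abs_mult mult_left_le)
    ultimately have "\<bar>w * h t ^ 3 - 3 * v 0 * h t\<bar> \<le> \<bar>w\<bar> + 3 * \<bar>v 0\<bar>" by linarith
    then have "\<bar>u t ^ 3\<bar> \<le> ?B"
      unfolding uh[OF t] abs_divide abs_mult abs_numeral by (rule divide_right_mono) simp
    \<comment> \<open>Either \<open>u t\<close> has absolute value at most 1, or it is dominated by
      its own cube.\<close>
    moreover have "\<bar>u t\<bar> \<le> 1 + \<bar>u t ^ 3\<bar>"
      using self_le_power[of "\<bar>u t\<bar>" 3] by (cases "\<bar>u t\<bar> \<le> 1") (auto simp: power_abs intro: add_increasing2)
    ultimately have "norm (u t, v t) \<le> (1 + ?B) + \<bar>v 0\<bar>"
      using norm_Pair_le[of "u t" "v t"] v by auto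
    then show "norm (x t) \<le> (1 + ?B) + \<bar>v 0\<bar>" by (simp add: x)
  qed
  then have gl: "t \<in> I" if "t \<ge> 0" for t using that by auto
  have ev0: "\<forall>\<^sub>F t in at_top. t \<ge> (0 :: real)" by (rule eventually_ge_at_top)
  \<comment> \<open>As \<open>h\<close> is positive and decreasing, its infimum is its limit; at
    this stage it may still be positive.\<close>
  define \<eta> where "\<eta> = (INF t\<in>{0..}. h t)"
  have bdd: "bdd_below (h ` {0..})" using h0 by (auto intro!: bdd_belowI less_imp_le)
  have h_lim: "(h \<longlongrightarrow> \<eta>) at_top"
  proof (rule decreasing_tendsto)
    show "\<forall>\<^sub>F t in at_top. \<eta> \<le> h t"
      using ev0 by eventually_elim (auto simp: \<eta>_def intro: cINF_lower bdd)
    fix y assume "\<eta> < y"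
    then obtain s where s: "s \<ge> 0" "h s < y"
      unfolding \<eta>_def using cINF_less_iff[of "{0..}" h y] bdd by auto
    show "\<forall>\<^sub>F t in at_top. h t < y"
      using eventually_ge_at_top[of s]
    proof eventually_elim
      case (elim t)
      then show ?case using h_mono[of s t] gl[of t] s by auto
    qed
  qed
  \<comment> \<open>These are the limits of \<open>v\<close> and \<open>u\<close> read off from
    \<open>vh\<close> and \<open>uh\<close>; the real cube root is continuous on the whole line and
    recovers \<open>u\<close> with its sign.\<close>
  define V U where "V = v 0 * \<eta>" and "U = root 3 ((w * \<eta> ^ 3 - 3 * v 0 * \<eta>) / (2 * c))"
  have "((\<lambda>t. v 0 * h t) \<longlongrightarrow> V) at_top"
    unfolding V_def by (intro tendsto_intros h_lim)
  moreover have "\<forall>\<^sub>F t in at_top. v 0 * h t = v t"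
    using ev0 by eventually_elim (simp add: gl flip: vh)
  ultimately have V: "(v \<longlongrightarrow> V) at_top" by (rule Lim_transform_eventually)
  have "((\<lambda>t. root 3 ((w * h t ^ 3 - 3 * v 0 * h t) / (2 * c))) \<longlongrightarrow> U) at_top"
    unfolding U_def using \<open>c < 0\<close> by (intro tendsto_intros h_lim) auto
  moreover have "\<forall>\<^sub>F t in at_top. root 3 ((w * h t ^ 3 - 3 * v 0 * h t) / (2 * c)) = u t"
    using ev0
  proof eventually_elim
    case (elim t)
    have "root 3 (u t ^ 3) = u t" by (rule odd_real_root_power_cancel) simp
    then show ?case using uh[of t] gl elim by simp
  qed
  ultimately have U: "(u \<longlongrightarrow> U) at_top" by (rule Lim_transform_eventually)
  \<comment> \<open>The velocities converge to the field at \<open>(U, V)\<close>, which must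
    therefore vanish. Substituting \<open>V = - c * U ^ 3\<close> into the second equation leaves a
    nonzero multiple of \<open>U ^ 5\<close>.\<close>
  have "((\<lambda>t. v t + c * u t ^ 3) \<longlongrightarrow> V + c * U ^ 3) at_top"
    and "((\<lambda>t. c * u t ^ 2 * v t) \<longlongrightarrow> c * U ^ 2 * V) at_top"
    by (intro tendsto_intros U V)+
  from tendsto_deriv_at_top_eq_0[OF U this(1) du] tendsto_deriv_at_top_eq_0[OF V this(2) dv] gl
  have "V + c * U ^ 3 = 0" "c * U ^ 2 * V = 0" by simp_all
  then have U0: "U = 0" and V0: "V = 0" using \<open>c < 0\<close> by auto
  obtain \<sigma> where \<sigma>: "\<bar>\<sigma>\<bar> = 1" "\<forall>\<^sub>F t in at_top. sgn (u t) = \<sigma>"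
    and slope: "((\<lambda>t. v t / u t) \<longlongrightarrow> 0) at_top"
  proof (cases "v 0 = 0")
    case True
    \<comment> \<open>The line \<open>v = 0\<close> is invariant, and on it
      \<open>u t = u 0 * h t\<close>: the sign of \<open>u\<close> is constant and the slope is
      identically 0.\<close>
    have "u 0 \<noteq> 0"
      using True orbit \<open>q \<noteq> (0, 0)\<close> by (auto simp: maximal_orbit_from_def x)
    moreover have "\<forall>\<^sub>F t in at_top. sgn (u t) = sgn (u 0)"
      using ev0
    proof eventually_elim
      case (elim t)
      have "u t ^ 3 = (u 0 * h t) ^ 3"
        using uh[of t] gl elim True \<open>c < 0\<close> by (simp add: w_def power_mult_distrib)
      then have "sgn (u t) = sgn (u 0 * h t)" using sgn_cube by metis
      then show ?case using h0[of t] by (simp add: sgn_mult)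
    qed
    moreover have "\<forall>\<^sub>F t in at_top. 0 = v t / u t"
      using ev0
    proof eventually_elim
      case (elim t)
      then show ?case using vh[of t] gl True by simp
    qed
    then have "((\<lambda>t. v t / u t) \<longlongrightarrow> 0) at_top"
      by (rule Lim_transform_eventually[OF tendsto_const])
    ultimately show thesis by (intro that[of "sgn (u 0)"]) (auto simp: abs_sgn_eq)
  next
    case False
    with V0 have \<eta>: "\<eta> = 0" by (simp add: V_def)
    \<comment> \<open>\<open>D\<close> is the quotient of \<open>u ^ 3\<close> by \<open>h\<close>.
      Its limit \<open>D0\<close> is nonzero, so it fixes the eventual sign of
      \<open>u\<close>.\<close>
    define D where "D t = (w * h t ^ 2 - 3 * v 0) / (2 * c)" for t
    define D0 where "D0 = - 3 * v 0 / (2 * c)"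
    have D0: "D0 \<noteq> 0" using False \<open>c < 0\<close> by (simp add: D0_def)
    have "(D \<longlongrightarrow> (w * \<eta> ^ 2 - 3 * v 0) / (2 * c)) at_top"
      unfolding D_def using \<open>c < 0\<close> by (intro tendsto_intros h_lim) auto
    then have D: "(D \<longlongrightarrow> D0) at_top" by (simp add: \<eta> D0_def)
    have uD: "u t ^ 3 = h t * D t" if "t \<ge> 0" for t
      using uh[of t] gl that by (simp add: D_def algebra_simps power2_eq_square power3_eq_cube)
    have "((\<lambda>t. sgn (D t)) \<longlongrightarrow> sgn D0) at_top" using D D0 by (rule tendsto_sgn)
    then have "\<forall>\<^sub>F t in at_top. dist (sgn (D t)) (sgn D0) < 1" by (rule tendstoD) simp
    \<comment> \<open>The values of \<open>sgn\<close> are -1, 0 and 1, so a distance below 1 means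
      equality.\<close>
    then have sgnD: "\<forall>\<^sub>F t in at_top. sgn (D t) = sgn D0"
      by eventually_elim (auto simp: sgn_real_def dist_real_def split: if_splits)
    have sgnu: "\<forall>\<^sub>F t in at_top. sgn (u t) = sgn D0"
      using ev0 sgnD
    proof eventually_elim
      case (elim t)
      have "sgn (u t) = sgn (h t * D t)" using uD[of t] elim sgn_cube by metis
      then show ?case using h0[of t] elim by (simp add: sgn_mult)
    qed
    \<comment> \<open>Writing \<open>v / u\<close> as \<open>v * u ^ 2 / u ^ 3\<close> cancels
      \<open>h\<close> and leaves \<open>v 0 / D t * u t ^ 2\<close>, which vanishes in the limit
      with \<open>u\<close>.\<close>
    have "((\<lambda>t. v 0 / D t * u t ^ 2) \<longlongrightarrow> v 0 / D0 * 0 ^ 2) at_top"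
      using U D D0 unfolding U0 by (intro tendsto_intros)
    moreover have "\<forall>\<^sub>F t in at_top. v 0 / D t * u t ^ 2 = v t / u t"
      using ev0 sgnD sgnu
    proof eventually_elim
      case (elim t)
      then have "u t \<noteq> 0" "D t \<noteq> 0" using D0 by (auto simp: sgn_zero_iff)
      then show ?case
        using uD[of t] vh[of t] gl elim
        by (simp add: field_simps power2_eq_square power3_eq_cube)
    qed
    ultimately have "((\<lambda>t. v t / u t) \<longlongrightarrow> v 0 / D0 * 0 ^ 2) at_top"
      by (rule Lim_transform_eventually)
    then show thesis using sgnu D0 by (intro that[of "sgn D0"]) (auto simp: abs_sgn_eq)
  qed
  have "tends_with_tangent x (0, 0) at_top"
    unfolding x using U V \<sigma> slope unfolding U0 V0 by (rule tends_with_horizontal_tangent)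
  with global show ?thesis ..
qed

section \<open>Stability for the two signs of c\<close>

text \<open>Every orbit other than the constant one at the origin is attracted, however far away it
  starts, so the neighbourhood may be given radius 1.\<close>

lemma cubic_field_stable_node:
  assumes "c < 0"
  shows "stable_node (cubic_field c) (0, 0)"
  unfolding stable_node_def
  using cubic_field_isolated[of c] cubic_field_orbit[OF assms] assms zero_less_one by blast

lemma cubic_field_unstable_node:
  assumes "c > 0"
  shows "unstable_node (cubic_field c) (0, 0)"
proof (rule unstable_node_reverse)
  let ?R = "\<lambda>p :: real \<times> real. (- fst p, snd p)"
  show "linear ?R" by (rule linearI) auto
  show "?R (?R p) = p" for p by simp
  show "norm (?R p) = norm p" for p by (simp add: norm_prod_def)
  show "cubic_field (- c) (?R p) = - ?R (cubic_field c p)" for p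
    by (simp add: cubic_field_def case_prod_unfold)
  show "stable_node (cubic_field (- c)) (?R (0, 0))"
    using cubic_field_stable_node[of "- c"] assms by simp
qed

theorem proposition6p1:
  fixes c :: real
  assumes "c \<noteq> 0"
  shows "let F = (\<lambda>(u, v). (v + c * u ^ 3, c * u ^ 2 * v)) in
     chart_U2 (\<lambda>x y. y) (\<lambda>x y. - c * x ^ 2) = F \<and>
     node F (0, 0) \<and>
     (c < 0 \<longrightarrow> stable_node F (0, 0)) \<and>
     (c > 0 \<longrightarrow> unstable_node F (0, 0))"
  unfolding Let_def node_def cubic_field_def[symmetric]
  using assms chart_U2_cubic_field[OF assms] cubic_field_stable_node cubic_field_unstable_node
  by (cases "c < 0") auto

end
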